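(* Let $\Omega\subset\mathbb{R}^2$ be a bounded polygonal domain and let $\{\mathcal{T}_h\}$ be a quasi-uniform family of triangulations of $\Omega$ with characteristic element diameter $h>0$. Let $K$ and $\bar K_{\mathrm{SSE}}$ be the stiffness matrices on $V_h$ of the standard finite element method and of the strain-smoothed element method (SSE), respectively, as defined in the context. Then $K$ and $\bar K_{\mathrm{SSE}}$ are spectrally equivalent: there exist two positive constants $\underline{C}$ and $\overline{C}$, independent of the mesh size $h$, such that $$\underline{C}\,u^TKu\le u^T\bar K_{\mathrm{SSE}}u\le \overline{C}\,u^TKu\qquad\forall u\in V_h .$$
   Context: Triangulations are conforming; quasi-uniform means shape-regular with all element diameters comparable to $h$, with constants independent of $h$. $\mathcal{P}_n(\omega)$ is the set of polynomials of degree at most $n$ on $\omega$. $V_h=\{v\in H_0^1(\Omega): v|_e\in\mathcal{P}_1(e)\ \forall e\in\mathcal{T}_h\}$. Functions in $V_h$ are identified with their vectors of nodal degrees of freedom. Standard stiffness matrix: $u^TKv=\int_\Omega\nabla u\cdot\nabla v\,d\Omega$ for $u,v\in V_h$. SSE: let $u\in V_h$ and $e\in\mathcal{T}_h$. Number the edges of $e$ by $k=1,2,3$ and let $e^{(k)}$ be the neighboring element of $e$ across the $k$th edge, if it exists. Set $$\hat\epsilon^{(k)}=\frac{|e|\,\nabla u|_e+|e^{(k)}|\,\nabla u|_{e^{(k)}}}{|e|+|e^{(k)}|}$$ if $e^{(k)}$ exists, and $\hat\epsilon^{(k)}=\nabla u|_e$ otherwise; here $|\cdot|$ denotes area. The smoothed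 gradient $\bar\nabla_{\mathrm{SSE}}u$ restricted to $e$ is the (vector-valued) linear polynomial whose values at the three Gaussian integration points $\mathrm{G}1,\mathrm{G}2,\mathrm{G}3$ of $e$ are $$\bar\nabla_{\mathrm{SSE}}u(\mathrm{G}k)=\tfrac12\left(\hat\epsilon^{(k-1)}+\hat\epsilon^{(k)}\right),\qquad \hat\epsilon^{(0)}:=\hat\epsilon^{(3)} .$$ The three-point Gauss rule on $e$ (equal weights $|e|/3$) is exact for quadratic polynomials. The SSE stiffness matrix is given, for $u,v\in V_h$, by $$u^T\bar K_{\mathrm{SSE}}v=\int_\Omega\bar\nabla_{\mathrm{SSE}}u\cdot\bar\nabla_{\mathrm{SSE}}v\,d\Omega=\sum_{e\in\mathcal{T}_h}\frac{|e|}{3}\sum_{k=1}^3\bar\nabla_{\mathrm{SSE}}u|_e(\mathrm{G}k)\cdot\bar\nabla_{\mathrm{SSE}}v|_e(\mathrm{G}k).$$ *)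

theory Defs
  imports "HOL-Analysis.Analysis"
begin

type_synonym point = "real^2"

text \<open>Slits are not excluded here; mesh edges lying on a slit are treated as boundary
  edges in \<open>neighbour\<close> below.\<close>

definition polygonal_domain :: "point set \<Rightarrow> bool" where
  "polygonal_domain \<Omega> \<longleftrightarrow>
     open \<Omega> \<and> connected \<Omega> \<and> bounded \<Omega> \<and> \<Omega> \<noteq> {} \<and>
     (\<exists>S. finite S \<and> (\<forall>(a, b)\<in>S. a \<noteq> b) \<and> frontier \<Omega> = (\<Union>(a, b)\<in>S. closed_segment a b))"

text \<open>Elements are closed triangles. Conformity is part of the library notion
  \<open>triangulation\<close>: any two elements intersect in a common face.\<close>

definition triangulation_of :: "point set \<Rightarrow> point set set \<Rightarrow> bool" where
  "triangulation_of \<Omega> \<T> \<longleftrightarrow>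
     triangulation \<T> \<and> (\<forall>e\<in>\<T>. 2 simplex e) \<and>
     \<Union>\<T> = closure \<Omega> \<and> (\<forall>e\<in>\<T>. interior e \<subseteq> \<Omega>)"

definition inradius :: "point set \<Rightarrow> real" where
  "inradius e = Sup {r. 0 \<le> r \<and> (\<exists>x. cball x r \<subseteq> e)}"

definition shape_regular :: "real set \<Rightarrow> (real \<Rightarrow> point set set) \<Rightarrow> bool" where
  "shape_regular H \<T> \<longleftrightarrow> (\<exists>\<sigma>>0. \<forall>h\<in>H. \<forall>e\<in>\<T> h. diameter e \<le> \<sigma> * inradius e)"

definition quasi_uniform :: "real set \<Rightarrow> (real \<Rightarrow> point set set) \<Rightarrow> bool" where
  "quasi_uniform H \<T> \<longleftrightarrow> shape_regular H \<T> \<and>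
     (\<exists>c1>0. \<exists>c2>0. \<forall>h\<in>H. \<forall>e\<in>\<T> h. c1 * h \<le> diameter e \<and> diameter e \<le> c2 * h)"

definition grad :: "(point \<Rightarrow> real) \<Rightarrow> point \<Rightarrow> point" where
  "grad u x = (THE D. GDERIV u x :> D)"

primrec Ck :: "nat \<Rightarrow> (point \<Rightarrow> real) \<Rightarrow> bool" where
  "Ck 0 f \<longleftrightarrow> continuous_on UNIV f"
| "Ck (Suc k) f \<longleftrightarrow> (\<exists>g. (\<forall>x. GDERIV f x :> g x) \<and> (\<forall>i. Ck k (\<lambda>x. g x $ i)))"

definition test_function :: "point set \<Rightarrow> (point \<Rightarrow> real) \<Rightarrow> bool" where
  "test_function \<Omega> \<phi> \<longleftrightarrow> (\<forall>k. Ck k \<phi>) \<and>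
     compact (closure {x. \<phi> x \<noteq> 0}) \<and> closure {x. \<phi> x \<noteq> 0} \<subseteq> \<Omega>"

text \<open>The closure of the test functions in the \<open>H\<^sup>1\<close> norm: by completeness,
  \<open>v\<close> is in it iff some test functions converge to \<open>v\<close> in \<open>L\<^sup>2\<close> while their gradients
  converge in \<open>L\<^sup>2\<close> (to the weak gradient \<open>g\<close> of \<open>v\<close>). Members are functions rather than
  equivalence classes; values outside \<open>\<Omega>\<close> and on null sets are irrelevant.\<close>

definition H10 :: "point set \<Rightarrow> (point \<Rightarrow> real) set" where
  "H10 \<Omega> = {v. set_borel_measurable lebesgue \<Omega> v \<and>
     (\<exists>g \<phi>. set_borel_measurable lebesgue \<Omega> g \<and> (\<forall>n::nat. test_function \<Omega> (\<phi> n)) \<and>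
       (\<lambda>n. \<integral>\<^sup>+x\<in>\<Omega>. ennreal ((\<phi> n x - v x)\<^sup>2) \<partial>lebesgue) \<longlonglongrightarrow> 0 \<and>
       (\<lambda>n. \<integral>\<^sup>+x\<in>\<Omega>. ennreal ((norm (grad (\<phi> n) x - g x))\<^sup>2) \<partial>lebesgue) \<longlonglongrightarrow> 0)}"

text \<open>Scalar- or vector-valued polynomials of degree at most one.\<close>

definition P1 :: "point set \<Rightarrow> (point \<Rightarrow> 'b::real_vector) set" where
  "P1 \<omega> = {f. \<exists>A b. linear A \<and> (\<forall>x\<in>\<omega>. f x = A x + b)}"

text \<open>Since the elements are closed, \<open>v\<close> is the (unique on \<open>closure \<Omega>\<close>) representative
  of its class that is a polynomial on each closed element.\<close>

definition V_h :: "point set \<Rightarrow> point set set \<Rightarrow> (point \<Rightarrow> real) set" where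
  "V_h \<Omega> \<T> = {v \<in> H10 \<Omega>. \<forall>e\<in>\<T>. v \<in> P1 e}"

text \<open>Stiffness matrices are represented by their bilinear forms
  \<open>(u, v) \<mapsto> u\<^sup>T K v\<close> on \<open>V_h\<close>. For \<open>u \<in> V_h\<close>, \<open>grad u\<close> exists in the interior of each
  element, hence almost everywhere.\<close>

definition K_std :: "point set \<Rightarrow> (point \<Rightarrow> real) \<Rightarrow> (point \<Rightarrow> real) \<Rightarrow> real" where
  "K_std \<Omega> u v = (LINT x:\<Omega>|lebesgue. grad u x \<bullet> grad v x)"

abbreviation area :: "point set \<Rightarrow> real" where
  "area e \<equiv> measure lebesgue e"

definition elem_grad :: "(point \<Rightarrow> real) \<Rightarrow> point set \<Rightarrow> point" where
  "elem_grad u e = (THE g. \<forall>x\<in>interior e. GDERIV u x :> g)"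

text \<open>Local numbering: \<open>p e 1, p e 2, p e 3\<close> are the vertices of \<open>e\<close>, and edge \<open>k\<close> joins
  vertices \<open>k\<close> and \<open>nxt k\<close>, so that edges \<open>prv k\<close> and \<open>k\<close> meet at vertex \<open>k\<close>.\<close>

definition nxt :: "nat \<Rightarrow> nat" where
  "nxt k = (if k = 3 then 1 else k + 1)"

definition prv :: "nat \<Rightarrow> nat" where
  "prv k = (if k = 1 then 3 else k - 1)"

type_synonym numbering = "point set \<Rightarrow> nat \<Rightarrow> point"

definition vertex_numbering :: "point set set \<Rightarrow> numbering \<Rightarrow> bool" where
  "vertex_numbering \<T> p \<longleftrightarrow> (\<forall>e\<in>\<T>. bij_betw (p e) {1, 2, 3} {x. x extreme_point_of e})"

definition edge :: "numbering \<Rightarrow> point set \<Rightarrow> nat \<Rightarrow> point set" where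
  "edge p e k = closed_segment (p e k) (p e (nxt k))"

definition neighbour ::
  "point set \<Rightarrow> point set set \<Rightarrow> numbering \<Rightarrow> point set \<Rightarrow> nat \<Rightarrow> point set \<Rightarrow> bool" where
  "neighbour \<Omega> \<T> p e k e' \<longleftrightarrow>
     e' \<in> \<T> \<and> e' \<noteq> e \<and> edge p e k \<subseteq> e' \<and> \<not> edge p e k \<subseteq> frontier \<Omega>"

definition edge_strain ::
  "point set \<Rightarrow> point set set \<Rightarrow> numbering \<Rightarrow> (point \<Rightarrow> real) \<Rightarrow> point set \<Rightarrow> nat \<Rightarrow> point" where
  "edge_strain \<Omega> \<T> p u e k =
     (if \<exists>e'. neighbour \<Omega> \<T> p e k e'
      then let e' = (THE e'. neighbour \<Omega> \<T> p e k e')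
           in (area e *\<^sub>R elem_grad u e + area e' *\<^sub>R elem_grad u e') /\<^sub>R (area e + area e')
      else elem_grad u e)"

text \<open>The interior three-point rule. Gauss point \<open>k\<close> is the one nearest to the vertex at
  which edges \<open>prv k\<close> and \<open>k\<close> meet.\<close>

definition gauss_pt :: "numbering \<Rightarrow> point set \<Rightarrow> nat \<Rightarrow> point" where
  "gauss_pt p e k = (2/3) *\<^sub>R p e k + (1/6) *\<^sub>R p e (nxt k) + (1/6) *\<^sub>R p e (prv k)"

definition SSE_poly ::
  "point set \<Rightarrow> point set set \<Rightarrow> numbering \<Rightarrow> (point \<Rightarrow> real) \<Rightarrow> point set \<Rightarrow> point \<Rightarrow> point" where
  "SSE_poly \<Omega> \<T> p u e =
     (THE f. f \<in> P1 UNIV \<and>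
        (\<forall>k\<in>{1, 2, 3}. f (gauss_pt p e k) =
           (1/2) *\<^sub>R (edge_strain \<Omega> \<T> p u e (prv k) + edge_strain \<Omega> \<T> p u e k)))"

text \<open>The element containing \<open>x\<close> is well defined for almost every \<open>x \<in> \<Omega>\<close>.\<close>

definition SSE_grad ::
  "point set \<Rightarrow> point set set \<Rightarrow> numbering \<Rightarrow> (point \<Rightarrow> real) \<Rightarrow> point \<Rightarrow> point" where
  "SSE_grad \<Omega> \<T> p u x = SSE_poly \<Omega> \<T> p u (THE e. e \<in> \<T> \<and> x \<in> interior e) x"

definition K_SSE ::
  "point set \<Rightarrow> point set set \<Rightarrow> numbering \<Rightarrow> (point \<Rightarrow> real) \<Rightarrow> (point \<Rightarrow> real) \<Rightarrow> real" where
  "K_SSE \<Omega> \<T> p u v = (LINT x:\<Omega>|lebesgue. SSE_grad \<Omega> \<T> p u x \<bullet> SSE_grad \<Omega> \<T> p v x)"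

end

theory Submission
  imports Defs
begin

text \<open>Lower bound, element by element: since \<open>u\<close> is continuous, the smoothed edge strain has the
  same tangential component as \<open>grad u\<close> on that edge, with no boundary condition needed. Both ends
  of the diameter parallel to \<open>grad u\<close> of an inscribed ball of radius \<open>r\<close> lie in the element, so \<open>2 r |grad u|\<close> is at most
  the largest edge increment of \<open>u\<close>; shape regularity then bounds \<open>|grad u|\<close> by the edge strains.
  The edge strains are recovered linearly from the vertex values of the smoothed gradient, and the
  \<open>L\<^sup>2\<close> norm of an affine function controls its vertex values.

  Upper bound: by convexity \<open>|e| |\<epsilon>|\<^sup>2 \<le> |e| |g|\<^sup>2 + |e'| |g'|\<^sup>2\<close> for the strain \<open>\<epsilon>\<close> on the
  edge between \<open>e\<close> and \<open>e'\<close>, so areas need not be compared, and each element is a neighbour of at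
  most three others.\<close>

subsection \<open>Affine functions on triangles\<close>

lemma affine_comb_noncollinear:
  fixes a b c x :: point
  assumes "\<not> collinear {a, b, c}"
  obtains u v w where "u + v + w = 1" "x = u *\<^sub>R a + v *\<^sub>R b + w *\<^sub>R c"
proof -
  have "\<not> affine_dependent {a, b, c}" "card {a, b, c} = Suc DIM(point)"
    using assms by (auto simp: collinear_3_eq_affine_dependent)
  then have "x \<in> affine hull {a, b, c}"
    using affine_independent_span_eq by blast
  then show thesis
    using that unfolding affine_hull_3 by blast
qed

lemma P1_affine_comb:
  assumes "f \<in> P1 \<omega>" "a \<in> \<omega>" "b \<in> \<omega>" "c \<in> \<omega>" "u *\<^sub>R a + v *\<^sub>R b + w *\<^sub>R c \<in> \<omega>" "u + v + w = 1"
  shows "f (u *\<^sub>R a + v *\<^sub>R b + w *\<^sub>R c) = u *\<^sub>R f a + v *\<^sub>R f b + w *\<^sub>R f c"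
proof -
  obtain A d where A: "linear A" "\<forall>x\<in>\<omega>. f x = A x + d"
    using assms(1) unfolding P1_def by blast
  have "d = (u + v + w) *\<^sub>R d"
    using assms by simp
  then show ?thesis
    using A assms by (simp add: linear_add linear_scale algebra_simps)
qed

text \<open>With \<open>a\<close> moved to the origin, \<open>b - a\<close> and \<open>c - a\<close>
  are independent, so values prescribed there extend linearly; the additive constant then restores
  the value at \<open>a\<close>.\<close>

lemma P1_interpolation:
  fixes a b c :: point and x y z :: "'b::real_vector"
  assumes "\<not> collinear {a, b, c}"
  obtains f where "f \<in> P1 UNIV" "f a = x" "f b = y" "f c = z"
proof -
  have ad: "\<not> affine_dependent {a, b, c}" and ne: "a \<noteq> b" "a \<noteq> c" "b \<noteq> c"
    using assms by (auto simp: collinear_3_eq_affine_dependent)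
  have "independent {x - a |x. x \<in> {b, c}}"
    using dependent_imp_affine_dependent[where a = a and S = "{b, c}"] ad ne by fast
  moreover have "{x - a |x. x \<in> {b, c}} = {b - a, c - a}"
    by fast
  ultimately have ind: "independent {b - a, c - a}"
    by (simp only: simp_thms)
  obtain A :: "point \<Rightarrow> 'b" where A: "linear A"
      "\<forall>t\<in>{b - a, c - a}. A t = (if t = b - a then y - x else z - x)"
    using linear_independent_extend[OF ind, of "\<lambda>t. if t = b - a then y - x else z - x"] by blast
  have "c - a \<noteq> b - a"
    using ne by simp
  then have "A (b - a) = y - x" "A (c - a) = z - x"
    using A(2) by auto
  then have "(\<lambda>t. A t + (x - A a)) b = y" "(\<lambda>t. A t + (x - A a)) c = z"
    using A(1) by (auto simp: linear_diff algebra_simps)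
  moreover have "(\<lambda>t. A t + (x - A a)) \<in> P1 UNIV"
    using A(1) unfolding P1_def by blast
  ultimately show thesis
    using that[of "\<lambda>t. A t + (x - A a)"] by (simp only: add_diff_cancel_left' diff_add_cancel add_diff_eq)
qed

lemma P1_eqI:
  fixes a b c :: point
  assumes "\<not> collinear {a, b, c}" "f \<in> P1 UNIV" "g \<in> P1 UNIV" "f a = g a" "f b = g b" "f c = g c"
  shows "f = g"
proof
  fix x
  obtain u v w where "u + v + w = 1" "x = u *\<^sub>R a + v *\<^sub>R b + w *\<^sub>R c"
    using affine_comb_noncollinear assms(1) by blast
  then show "f x = g x"
    using P1_affine_comb[of f UNIV] P1_affine_comb[of g UNIV] assms by simp
qed

text \<open>An affinely independent set is recovered from its convex hull as the set of extreme
  points, so the numbered points are exactly the vertices spanning the simplex.\<close>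

lemma simplex_numbering:
  fixes e :: "point set" and q :: "nat \<Rightarrow> point"
  assumes "2 simplex e" "bij_betw q {1, 2, 3} {x. x extreme_point_of e}"
  shows "\<not> collinear {q 1, q 2, q 3}" "e = convex hull {q 1, q 2, q 3}"
proof -
  obtain C where C: "\<not> affine_dependent C" "int (card C) = 3" "e = convex hull C"
    using assms(1) unfolding simplex_def by auto
  have "{x. x extreme_point_of e} = C"
    using extreme_point_of_convex_hull_affine_independent[OF C(1)] C(3) by auto
  then have C2: "C = {q 1, q 2, q 3}"
    using assms(2) unfolding bij_betw_def by auto
  have "inj_on q {1, 2, 3}"
    using assms(2) unfolding bij_betw_def by auto
  then have "q 1 \<noteq> q 2" "q 1 \<noteq> q 3" "q 2 \<noteq> q 3"
    by (auto simp: inj_on_def)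
  then show "\<not> collinear {q 1, q 2, q 3}"
    using C C2 by (auto simp: collinear_3_eq_affine_dependent)
  show "e = convex hull {q 1, q 2, q 3}"
    using C C2 by simp
qed

text \<open>The norm of an affine function is convex, so on a triangle it is bounded by its largest
  vertex value.\<close>

lemma P1_norm_le:
  fixes f :: "point \<Rightarrow> 'b::real_normed_vector"
  assumes "f \<in> P1 (convex hull {a, b, c})" "norm (f a) \<le> M" "norm (f b) \<le> M" "norm (f c) \<le> M"
    and "x \<in> convex hull {a, b, c}"
  shows "norm (f x) \<le> M"
proof -
  obtain u v w where *: "0 \<le> u" "0 \<le> v" "0 \<le> w" "u + v + w = 1" "x = u *\<^sub>R a + v *\<^sub>R b + w *\<^sub>R c"
    using assms(5) unfolding convex_hull_3 by blast
  have "f x = u *\<^sub>R f a + v *\<^sub>R f b + w *\<^sub>R f c"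
    using * assms P1_affine_comb[of f "convex hull {a,b,c}" a b c u v w]
    by (simp add: hull_inc)
  then have "norm (f x) \<le> norm (u *\<^sub>R f a) + norm (v *\<^sub>R f b) + norm (w *\<^sub>R f c)"
    by (metis norm_triangle_le norm_triangle_ineq add_right_mono)
  also have "\<dots> \<le> u * M + v * M + w * M"
    using * assms by (auto intro!: add_mono mult_left_mono)
  also have "\<dots> = M"
    using * by (metis distrib_right mult_1)
  finally show ?thesis .
qed

lemma P1_mono: "f \<in> P1 T \<Longrightarrow> S \<subseteq> T \<Longrightarrow> f \<in> P1 S"
  unfolding P1_def by blast

lemma continuous_on_P1:
  fixes f :: "point \<Rightarrow> 'b::real_normed_vector"
  assumes "f \<in> P1 S"
  shows "continuous_on S f"
proof -
  obtain A d where A: "linear A" "\<forall>x\<in>S. f x = A x + d"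
    using assms unfolding P1_def by blast
  have "continuous_on S (\<lambda>x. A x + d)"
    by (intro continuous_intros linear_continuous_on linear_conv_bounded_linear[THEN iffD1] A)
  then show ?thesis
    using A(2) continuous_on_cong by (metis (no_types, lifting))
qed

text \<open>Stated on the interior because element interiors are disjoint and fill the domain up to
  a null set. Integrability is inherited from the compact element, where the integrand is
  continuous.\<close>

lemma P1_square_integrable:
  fixes f :: "point \<Rightarrow> point"
  assumes "f \<in> P1 e" "compact e" 
  shows "set_integrable lebesgue (interior e) (\<lambda>x. f x \<bullet> f x)"
proof -
  have "continuous_on e (\<lambda>x. f x \<bullet> f x)"
    by (intro continuous_intros continuous_on_P1 assms)
  then have "set_integrable lborel e (\<lambda>x. f x \<bullet> f x)"
    using assms(2) borel_integrable_compact[of e "\<lambda>x. f x \<bullet> f x"]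
    unfolding set_integrable_def by (simp add: indicator_scaleR_eq_if)
  then have "set_integrable lebesgue e (\<lambda>x. f x \<bullet> f x)"
    using integrable_completion[of "\<lambda>x. indicat_real e x *\<^sub>R (f x \<bullet> f x)" lborel]
      borel_measurable_integrable[of lborel "\<lambda>x. indicat_real e x *\<^sub>R (f x \<bullet> f x)"]
    unfolding set_integrable_def by simp
  then show ?thesis
    by (rule set_integrable_subset) (auto simp: interior_subset)
qed

text \<open>The centroid, with all barycentric coordinates equal to 1/3, is an interior
  point.\<close>

lemma noncollinear_interior_nonempty:
  fixes a b c :: point
  assumes "\<not> collinear {a, b, c}"
  shows "interior (convex hull {a, b, c}) \<noteq> {}"
  using interior_convex_hull_3_minimal[OF assms]
  by (auto intro!: exI[of _ "1/3::real"])

lemma P1_square_integral_le: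
  fixes f :: "point \<Rightarrow> point"
  assumes "f \<in> P1 e" "e = convex hull {a, b, c}" "norm (f a) \<le> M" "norm (f b) \<le> M" "norm (f c) \<le> M"
  shows "(LINT x:interior e|lebesgue. f x \<bullet> f x) \<le> area e * M\<^sup>2"
proof -
  have comp: "compact e"
    using assms(2) by (simp add: compact_convex_hull finite_imp_compact)
  have ie: "interior e \<in> lmeasurable"
    using comp lmeasurable_interior compact_imp_bounded by blast
  have "(LINT x:interior e|lebesgue. f x \<bullet> f x) \<le> (LINT x:interior e|lebesgue. M\<^sup>2)"
  proof (rule set_integral_mono[OF P1_square_integrable])
    show "set_integrable lebesgue (interior e) (\<lambda>x. M\<^sup>2)"
      using ie by (auto simp: set_integrable_def fmeasurable_def intro!: integrable_scaleR_left integrable_real_indicator)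
    fix x assume "x \<in> interior e"
    then have "norm (f x) \<le> M"
      using P1_norm_le[of f a b c M x] assms interior_subset by blast
    then show "f x \<bullet> f x \<le> M\<^sup>2"
      by (simp add: power2_norm_eq_inner[symmetric] power_mono)
  qed (use comp assms in auto)
  also have "\<dots> = measure lebesgue (interior e) * M\<^sup>2"
    using ie by (simp add: set_integral_const fmeasurable_def)
  \<comment> \<open>The frontier of a convex set is null, so the triangle and its interior have the
    same area.\<close>
  also have "\<dots> = area e * M\<^sup>2"
    using measure_interior[of e] comp negligible_convex_frontier[of e] assms(2)
    by (simp add: compact_imp_bounded)
  finally show ?thesis .
qed

text \<open>On the image of the triangle under the homothety with centre \<open>a\<close> and ratio \<open>1/4\<close> the
  norm of \<open>f\<close> is at least \<open>3/4 M - 1/4 M\<close>.\<close>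

lemma P1_square_integral_ge:
  fixes f :: "point \<Rightarrow> point"
  assumes "f \<in> P1 e" "e = convex hull {a, b, c}" "norm (f a) = M" "norm (f b) \<le> M" "norm (f c) \<le> M"
  shows "area e * M\<^sup>2 \<le> 64 * (LINT x:interior e|lebesgue. f x \<bullet> f x)"
proof -
  have comp: "compact e"
    using assms(2) by (simp add: compact_convex_hull finite_imp_compact)
  have ie: "interior e \<in> lmeasurable"
    using comp lmeasurable_interior compact_imp_bounded by blast
  have aE: "a \<in> e"
    using assms(2) by (simp add: hull_inc)
  define S where "S = (\<lambda>x. (1/4) *\<^sub>R x + (3/4) *\<^sub>R a) ` interior e"
  \<comment> \<open>A homothety of ratio 1/4 in the plane multiplies areas by 1/16.\<close>
  have mS: "measure lebesgue S = measure lebesgue (interior e) / 16"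
    unfolding S_def using measure_lebesgue_affine[of "1/4" "(3/4) *\<^sub>R a" "interior e"]
    by (simp add: power2_eq_square add.commute)
  have mSe: "measure lebesgue (interior e) = area e"
    using measure_interior[of e] comp negligible_convex_frontier[of e] assms(2)
    by (simp add: compact_imp_bounded)
  have Ssub: "S \<subseteq> interior e"
  proof
    fix y assume "y \<in> S"
    then obtain x where x: "x \<in> interior e" "y = (1/4) *\<^sub>R x + (3/4) *\<^sub>R a"
      unfolding S_def by blast
    \<comment> \<open>Moving from a point of a convex set part of the way to an interior point leads
      into the interior.\<close>
    have "a - (1/4) *\<^sub>R (a - x) \<in> interior e"
      by (rule mem_interior_convex_shrink) (use x aE assms in auto)
    moreover have "a - (1/4) *\<^sub>R (a - x) = y"
      unfolding x(2) by (simp add: vec_eq_iff field_simps)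
    ultimately show "y \<in> interior e"
      by simp
  qed
  have Sm: "S \<in> lmeasurable"
  proof -
    have "open S"
    proof -
      have "S = (+) ((3/4) *\<^sub>R a) ` ((\<lambda>x. (1/4) *\<^sub>R x) ` interior e)"
        unfolding S_def image_image by (simp add: add.commute)
      then show ?thesis
        by (simp add: open_scaling open_translation)
    qed
    moreover have "bounded S"
      using Ssub comp bounded_subset compact_imp_bounded interior_subset by metis
    ultimately show ?thesis
      by (simp add: lmeasurable_open)
  qed
  have lower: "(M/2)\<^sup>2 \<le> f y \<bullet> f y" if y: "y \<in> S" for y
  proof -
    obtain x where x: "x \<in> interior e" "y = (1/4) *\<^sub>R x + (3/4) *\<^sub>R a"
      using y unfolding S_def by blast
    have xe: "x \<in> e" "y \<in> e"
      using x Ssub y interior_subset by blast+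
    have "f y = (1/4) *\<^sub>R f x + (3/4) *\<^sub>R f a"
      using P1_affine_comb[of f e x a a "1/4" "3/4" 0] x xe aE assms(1) by simp
    then have "norm (f y) \<ge> 3/4 * norm (f a) - 1/4 * norm (f x)"
      using norm_diff_ineq[of "(3/4) *\<^sub>R f a" "(1/4) *\<^sub>R f x"] by (simp add: add.commute)
    moreover have "norm (f x) \<le> M"
      using P1_norm_le[of f a b c M x] assms xe by auto
    ultimately have "M/2 \<le> norm (f y)"
      using assms(3) by linarith
    moreover have "0 \<le> M"
      using assms(3) by auto
    ultimately show ?thesis
      by (simp add: power2_norm_eq_inner[symmetric] power_mono)
  qed
  have int: "set_integrable lebesgue (interior e) (\<lambda>x. f x \<bullet> f x)"
    using P1_square_integrable comp assms by blast
  have intS: "set_integrable lebesgue S (\<lambda>x. f x \<bullet> f x)"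
    using set_integrable_subset[OF int _ Ssub] Sm by auto
  \<comment> \<open>The factor 64 is 16 from the area of \<open>S\<close> times 4 from the lower
    bound \<open>M/2\<close> on the norm.\<close>
  have "area e * M\<^sup>2 = 64 * (measure lebesgue S * (M/2)\<^sup>2)"
    using mS mSe by (simp add: power2_eq_square)
  also have "measure lebesgue S * (M/2)\<^sup>2 = (LINT x:S|lebesgue. (M/2)\<^sup>2)"
    using Sm by (subst set_integral_const) (auto simp: fmeasurable_def)
  also have "\<dots> \<le> (LINT x:S|lebesgue. f x \<bullet> f x)"
  proof (rule set_integral_mono[OF _ intS])
    show "set_integrable lebesgue S (\<lambda>x. (M/2)\<^sup>2)"
      using Sm by (auto simp: set_integrable_def fmeasurable_def intro!: integrable_scaleR_left integrable_real_indicator)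
  qed (use lower in auto)
  also have "\<dots> \<le> (LINT x:interior e|lebesgue. f x \<bullet> f x)"
    unfolding set_lebesgue_integral_def
  proof (rule integral_mono)
    show "integrable lebesgue (\<lambda>x. indicat_real S x *\<^sub>R (f x \<bullet> f x))"
      using intS unfolding set_integrable_def .
    show "integrable lebesgue (\<lambda>x. indicat_real (interior e) x *\<^sub>R (f x \<bullet> f x))"
      using int unfolding set_integrable_def .
  qed (use Ssub in \<open>auto simp: indicator_def\<close>)
  finally show ?thesis by simp
qed

subsection \<open>Conforming triangulations of the plane\<close>

text \<open>By conformity the intersection is a face of both elements. A vertex of \<open>e\<close>
  lying in \<open>e'\<close> is a face of that intersection, and a face of a face is a face.\<close>

lemma extreme_point_transfer:
  assumes "triangulation \<T>" "e \<in> \<T>" "e' \<in> \<T>" "x extreme_point_of e" "x \<in> e'"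
  shows "x extreme_point_of e'"
proof -
  have "{x} face_of e"
    using assms(4) by (simp add: face_of_singleton)
  have "x \<in> e"
    using assms(4) unfolding extreme_point_of_def by (rule conjunct1)
  with \<open>{x} face_of e\<close> have "{x} face_of (e \<inter> e')"
    using assms(5) by (intro face_of_subset[of "{x}" e "e \<inter> e'"]) blast+
  moreover have "(e \<inter> e') face_of e'"
    using assms(1-3) unfolding triangulation_def by (metis Int_commute)
  ultimately show ?thesis
    using face_of_trans face_of_singleton by blast
qed

text \<open>The common part is a face of each element, and a face that meets the interior is the
  whole set.\<close>

lemma triangulation_eq_if_interiors_meet:
  assumes "triangulation \<T>" "e \<in> \<T>" "e' \<in> \<T>" "x \<in> interior e" "x \<in> interior e'"
  shows "e = e'"
proof -
  have "(e \<inter> e') face_of e" "(e' \<inter> e) face_of e'"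
    using assms(1-3) unfolding triangulation_def by blast+
  moreover have "x \<in> e \<inter> e'"
    using assms interior_subset by blast
  ultimately have "e \<inter> e' = e" "e' \<inter> e = e'"
    using assms(4,5) face_of_disjoint_interior by blast+
  then show ?thesis
    by blast
qed

lemma mem_interior_triangle:
  fixes a b c :: point
  assumes "\<not> collinear {a, b, c}" "0 < u" "0 < v" "0 < w" "u + v + w = 1"
  shows "u *\<^sub>R a + v *\<^sub>R b + w *\<^sub>R c \<in> interior (convex hull {a, b, c})"
  using interior_convex_hull_3_minimal[OF assms(1)] assms(2-) by fastforce

text \<open>A positive coefficient \<open>w\<close> puts \<open>c\<close> and \<open>c'\<close> on
  the same side of the line through \<open>a\<close> and \<open>b\<close>. The midpoint of that
  edge, pushed slightly towards \<open>c'\<close>, is then interior to both triangles.\<close>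

lemma triangulation_eq_if_same_side:
  fixes a b c c' :: point
  assumes "triangulation \<T>" "convex hull {a, b, c} \<in> \<T>" "convex hull {a, b, c'} \<in> \<T>"
    and nc: "\<not> collinear {a, b, c}" "\<not> collinear {a, b, c'}"
    and c': "c' = u *\<^sub>R a + v *\<^sub>R b + w *\<^sub>R c" "u + v + w = 1" "0 < w"
  shows "convex hull {a, b, c} = convex hull {a, b, c'}"
proof -
  \<comment> \<open>The step is small enough that the coordinates of \<open>a\<close> and
    \<open>b\<close> with respect to \<open>a\<close>, \<open>b\<close>, \<open>c\<close>, namely
    \<open>1/2 - t/2 + t * u\<close> and \<open>1/2 - t/2 + t * v\<close>, stay positive.\<close>
  define t where "t = 1 / (2 * (1 + \<bar>u\<bar> + \<bar>v\<bar>))"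
  have t: "0 < t"
    unfolding t_def by (simp add: add_pos_nonneg)
  have "t * (1 + \<bar>u\<bar> + \<bar>v\<bar>) = 1/2"
    unfolding t_def by (simp add: field_simps add_pos_nonneg)
  then have "t + t * \<bar>u\<bar> + t * \<bar>v\<bar> = 1/2"
    by (simp add: distrib_left)
  moreover have tu: "0 \<le> t * \<bar>u\<bar>" and "0 \<le> t * \<bar>v\<bar>"
    using t by (auto intro!: mult_nonneg_nonneg)
  ultimately have tu2: "t / 2 + t * \<bar>u\<bar> < 1/2" and tv2: "t / 2 + t * \<bar>v\<bar> < 1/2"
    using t by linarith+
  have tuv: "- (t * u) \<le> t * \<bar>u\<bar>" "- (t * v) \<le> t * \<bar>v\<bar>"
    using t mult_left_mono[of "- u" "\<bar>u\<bar>" t] mult_left_mono[of "- v" "\<bar>v\<bar>" t] by auto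
  define x where "x = (1/2 - t/2) *\<^sub>R a + (1/2 - t/2) *\<^sub>R b + t *\<^sub>R c'"
  have x: "x = (1/2 - t/2 + t * u) *\<^sub>R a + (1/2 - t/2 + t * v) *\<^sub>R b + (t * w) *\<^sub>R c"
    unfolding x_def c'(1) by (simp add: algebra_simps)
  have sum: "(1/2 - t/2 + t * u) + (1/2 - t/2 + t * v) + t * w = 1"
  proof -
    have "t * u + t * v + t * w = t"
      by (metis c'(2) distrib_left mult.right_neutral)
    then show ?thesis by simp
  qed
  have pos: "0 < 1/2 - t/2 + t * u" "0 < 1/2 - t/2 + t * v" "0 < t * w" "0 < 1/2 - t/2"
    using t tuv tu2 tv2 tu c'(3) by (linarith, linarith, simp, linarith)
  have "x \<in> interior (convex hull {a, b, c})"
    unfolding x using mem_interior_triangle[OF nc(1) pos(1-3) sum] .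
  moreover have "(1/2 - t/2) + (1/2 - t/2) + t = 1"
    by simp
  then have "x \<in> interior (convex hull {a, b, c'})"
    unfolding x_def using mem_interior_triangle[OF nc(2) pos(4,4) t] by blast
  ultimately show ?thesis
    using triangulation_eq_if_interiors_meet assms(1-3) by blast
qed

lemma triangle_third_vertex:
  fixes e :: "point set"
  assumes "2 simplex e" "a extreme_point_of e" "b extreme_point_of e" "a \<noteq> b"
  obtains c where "\<not> collinear {a, b, c}" "e = convex hull {a, b, c}"
proof -
  obtain C where C: "\<not> affine_dependent C" "int (card C) = 3" "e = convex hull C"
    using assms(1) unfolding simplex_def by auto
  have "a \<in> C" "b \<in> C"
    using extreme_point_of_convex_hull_affine_independent[OF C(1)] C(3) assms by auto
  moreover have "card C = 3"
    using C(2) by simp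
  ultimately have "card (C - {a, b}) = 1"
    using assms(4) by (subst card_Diff_subset) auto
  then obtain c where "C - {a, b} = {c}"
    using card_1_singletonE by blast
  then have "C = {a, b, c}" "a \<noteq> c" "b \<noteq> c"
    using \<open>a \<in> C\<close> \<open>b \<in> C\<close> by auto
  then show thesis
    using that C assms(4) by (auto simp: collinear_3_eq_affine_dependent)
qed

text \<open>Any element other than \<open>e0\<close> with vertices \<open>a\<close> and
  \<open>b\<close> has its third vertex strictly across the line \<open>a b\<close> from that of
  \<open>e0\<close>. Two such elements therefore lie on the same side and coincide.\<close>

lemma triangulation_third_triangle:
  fixes e0 e1 e2 :: "point set"
  assumes T: "triangulation \<T>" "\<And>e. e \<in> \<T> \<Longrightarrow> 2 simplex e"
    and e: "e0 \<in> \<T>" "e1 \<in> \<T>" "e2 \<in> \<T>" "e1 \<noteq> e0" "e2 \<noteq> e0"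
    and ab: "a extreme_point_of e0" "b extreme_point_of e0" "a \<noteq> b"
    and sub: "a \<in> e1" "b \<in> e1" "a \<in> e2" "b \<in> e2"
  shows "e1 = e2"
proof -
  have ext: "a extreme_point_of e1" "b extreme_point_of e1" "a extreme_point_of e2" "b extreme_point_of e2"
    using extreme_point_transfer[OF T(1)] e ab sub by blast+
  obtain c0 where c0: "\<not> collinear {a, b, c0}" "e0 = convex hull {a, b, c0}"
    using triangle_third_vertex T(2) e ab by metis
  obtain c1 where c1: "\<not> collinear {a, b, c1}" "e1 = convex hull {a, b, c1}"
    using triangle_third_vertex T(2) e ab ext by metis
  obtain c2 where c2: "\<not> collinear {a, b, c2}" "e2 = convex hull {a, b, c2}"
    using triangle_third_vertex T(2) e ab ext by metis
  have opposite: "w < 0"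
    if "u + v + w = 1" "c = u *\<^sub>R a + v *\<^sub>R b + w *\<^sub>R c0" "\<not> collinear {a, b, c}"
      "convex hull {a, b, c} \<in> \<T>" "convex hull {a, b, c} \<noteq> e0" for u v w c
  proof (rule ccontr)
    assume "\<not> w < 0"
    moreover have "w \<noteq> 0"
    proof
      assume "w = 0"
      then have "u = 1 - v" "c = u *\<^sub>R a + v *\<^sub>R b"
        using that by auto
      then have "c \<in> affine hull {a, b}"
        unfolding affine_hull_2 using \<open>w = 0\<close> that(1) by auto
      then show False
        using that(3) ab(3) collinear_3_affine_hull by blast
    qed
    ultimately show False
      using triangulation_eq_if_same_side[OF T(1), of a b c0 c u v w] that c0 e by auto
  qed
  obtain u1 v1 w1 where 1: "u1 + v1 + w1 = 1" "c1 = u1 *\<^sub>R a + v1 *\<^sub>R b + w1 *\<^sub>R c0"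
    using affine_comb_noncollinear c0(1) by blast
  obtain u2 v2 w2 where 2: "u2 + v2 + w2 = 1" "c2 = u2 *\<^sub>R a + v2 *\<^sub>R b + w2 *\<^sub>R c0"
    using affine_comb_noncollinear c0(1) by blast
  have w: "w1 < 0" "w2 < 0"
    using opposite 1 2 c1 c2 e by blast+
  \<comment> \<open>Eliminating \<open>c0\<close> between the two expansions makes \<open>r\<close>
    the coordinate of \<open>c2\<close> at \<open>c1\<close>; it is positive as a quotient of two
    negative numbers.\<close>
  define r where "r = w2 / w1"
  have r: "0 < r" "w2 = r * w1"
    using w by (auto simp: r_def divide_neg_neg)
  have "c2 = (u2 - r * u1) *\<^sub>R a + (v2 - r * v1) *\<^sub>R b + r *\<^sub>R c1"
    unfolding 1(2) 2(2) r(2) by (simp add: algebra_simps)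
  moreover have "(u2 - r * u1) + (v2 - r * v1) + r = 1"
  proof -
    have "u2 + v2 + r * (1 - u1 - v1) = 1"
      using 1(1) 2(1) r(2) by (metis add.commute add_diff_cancel_left' diff_diff_eq)
    then show ?thesis by (simp add: algebra_simps)
  qed
  ultimately show ?thesis
    using triangulation_eq_if_same_side[OF T(1), of a b c1 c2] c1 c2 e r by auto
qed

section \<open>Element gradients and inscribed balls\<close>

lemma gderiv_unique: "GDERIV f x :> D \<Longrightarrow> GDERIV f x :> D' \<Longrightarrow> D = D'"
proof -
  assume "GDERIV f x :> D" "GDERIV f x :> D'"
  then have "(\<lambda>h. h \<bullet> D) = (\<lambda>h. h \<bullet> D')"
    unfolding gderiv_def by (rule has_derivative_unique)
  then have "(D - D') \<bullet> D = (D - D') \<bullet> D'"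
    by metis
  then have "(D - D') \<bullet> (D - D') = 0"
    by (simp add: inner_diff_right)
  then show ?thesis by simp
qed

text \<open>Uniqueness of the gradient on the open interior resolves the descriptions in
  \<open>grad\<close> and \<open>elem_grad\<close> to the vector representing the linear part. The
  increment formula reaches the vertices because \<open>u\<close> is affine on the closed
  element.\<close>

lemma elem_grad_P1:
  fixes u :: "point \<Rightarrow> real"
  assumes "u \<in> P1 e" "interior e \<noteq> {}"
  shows "\<And>x. x \<in> interior e \<Longrightarrow> grad u x = elem_grad u e"
    and "\<And>x y. x \<in> e \<Longrightarrow> y \<in> e \<Longrightarrow> elem_grad u e \<bullet> (y - x) = u y - u x"
proof -
  obtain A d where A: "linear A" "\<forall>x\<in>e. u x = A x + d"
    using assms(1) unfolding P1_def by blast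
  \<comment> \<open>The Riesz representer of the functional \<open>A\<close>.\<close>
  define g where "g = adjoint A 1"
  have Ag: "A x = x \<bullet> g" for x
    unfolding g_def using adjoint_works[OF A(1), of x 1] by (simp add: inner_commute)
  have der: "GDERIV u x :> g" if x: "x \<in> interior e" for x
  proof -
    have "((\<lambda>x. x \<bullet> g + d) has_derivative (\<lambda>h. h \<bullet> g)) (at x)"
      by (auto intro!: derivative_eq_intros)
    then have "(u has_derivative (\<lambda>h. h \<bullet> g)) (at x)"
      by (rule has_derivative_transform_within_open[of _ _ _ _ "interior e"])
        (use x A(2) Ag interior_subset[of e] in auto)
    then show ?thesis
      unfolding gderiv_def .
  qed
  have eg: "elem_grad u e = g"
    unfolding elem_grad_def by (rule the_equality) (use der gderiv_unique assms(2) in blast)+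
  show "grad u x = elem_grad u e" if "x \<in> interior e" for x
    unfolding grad_def eg by (rule the_equality) (use der gderiv_unique that in blast)+
  show "elem_grad u e \<bullet> (y - x) = u y - u x" if "x \<in> e" "y \<in> e" for x y
    unfolding eg using that A(2) Ag by (simp add: inner_diff_right inner_commute)
qed

lemma inscribed_ball_gradient_le:
  fixes a b c g :: point
  assumes "cball x r \<subseteq> convex hull {a, b, c}" "0 < r"
    and "\<bar>g \<bullet> (b - a)\<bar> \<le> D" "\<bar>g \<bullet> (c - b)\<bar> \<le> D" "\<bar>g \<bullet> (a - c)\<bar> \<le> D"
  shows "2 * r * norm g \<le> D"
proof (cases "g = 0")
  case True
  then show ?thesis using assms(3) by auto
next
  case False
  let ?e = "convex hull {a, b, c}"
  have "linear (\<lambda>x. g \<bullet> x)" "linear (\<lambda>x. - (g \<bullet> x))"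
    by (auto intro!: linearI simp: inner_add_right)
  then have P1: "(\<lambda>y. g \<bullet> (y - z)) \<in> P1 ?e" "(\<lambda>y. g \<bullet> (z - y)) \<in> P1 ?e" for z
    unfolding P1_def inner_diff_right mem_Collect_eq
    by (metis diff_conv_add_uminus, metis add_uminus_conv_diff add.commute)
  have sym: "\<bar>g \<bullet> (v - w)\<bar> = \<bar>g \<bullet> (w - v)\<bar>" for v w
    by (simp add: inner_diff_right abs_minus_commute)
  have D: "0 \<le> D" 
    using assms(3) by linarith
  \<comment> \<open>An increment is affine in each of its two end points, so its bound passes from
    pairs of vertices to all pairs, one argument at a time.\<close>
  have 1: "\<bar>g \<bullet> (v - w)\<bar> \<le> D" if "v \<in> ?e" "w \<in> {a, b, c}" for v w
    using P1_norm_le[OF P1(1)[of w] _ _ _ that(1), of D] that(2) assms sym D by auto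
  have 2: "\<bar>g \<bullet> (v - w)\<bar> \<le> D" if "v \<in> ?e" "w \<in> ?e" for v w
    using P1_norm_le[OF P1(2)[of v] _ _ _ that(2), of D] 1[OF that(1)] by auto
  define n where "n = (r / norm g) *\<^sub>R g"
  have "norm n = r"
    using False assms(2) by (simp add: n_def)
  then have "x + n \<in> ?e" "x - n \<in> ?e"
    using assms(1) by (auto simp: dist_norm subset_iff)
  then have "\<bar>g \<bullet> ((x + n) - (x - n))\<bar> \<le> D"
    by (rule 2)
  moreover have "g \<bullet> ((x + n) - (x - n)) = 2 * r * norm g"
  proof -
    have "(x + n) - (x - n) = 2 *\<^sub>R n"
      by (simp add: scaleR_2)
    then have "(x + n) - (x - n) = (2 * r / norm g) *\<^sub>R g"
      by (simp add: n_def)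
    then show ?thesis
      using False by (simp add: dot_square_norm power2_eq_square)
  qed
  ultimately show ?thesis
    by linarith
qed

text \<open>The inradius is a supremum, so an actual ball is only claimed with radius above half of
  it; this is the origin of the factor 2.\<close>

lemma inscribed_ball:
  fixes e :: "point set"
  assumes "diameter e \<le> \<sigma> * inradius e" "0 < \<sigma>" "0 < diameter e"
  obtains x r where "0 < r" "cball x r \<subseteq> e" "diameter e \<le> 2 * \<sigma> * r"
proof -
  have pos: "0 < inradius e"
    using assms by (meson less_le_trans zero_less_mult_pos)
  let ?X = "{r. 0 \<le> r \<and> (\<exists>x. cball x r \<subseteq> e)}"
  have "?X \<noteq> {}"
  proof -
    obtain x where "x \<in> e"
      using assms(3) by fastforce
    then have "0 \<in> ?X" by auto
    then show ?thesis by blast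
  qed
  moreover have "inradius e / 2 < Sup ?X"
    using pos unfolding inradius_def[symmetric] by simp
  ultimately obtain r where r: "r \<in> ?X" "inradius e / 2 < r"
    using less_cSupD by meson
  then obtain x where "cball x r \<subseteq> e" by blast
  moreover have "0 < r" using r pos by linarith
  moreover have "\<sigma> * inradius e \<le> \<sigma> * (2 * r)"
    using r assms(2) by (intro mult_left_mono) auto
  ultimately show thesis
    using that[of r x] assms(1) by (simp add: mult.assoc mult.left_commute)
qed

subsection \<open>The smoothed gradient\<close>

lemma nxt_prv_simps [simp]:
  "nxt 1 = 2" "nxt 2 = 3" "nxt 3 = 1" "prv 1 = 3" "prv 2 = 1" "prv 3 = 2" "nxt (Suc 0) = 2" "prv (Suc 0) = 3"
  by (auto simp: nxt_def prv_def)

text \<open>The map from edge strains to vertex values and its inverse both have this shape, so the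
  estimate serves in both directions.\<close>

lemma norm_vertex_value_le:
  fixes x y z :: "'a::real_normed_vector"
  shows "norm ((2/3) *\<^sub>R (x + y) - (1/3) *\<^sub>R z) \<le> 2/3 * (norm x + norm y) + 1/3 * norm z"
proof -
  have "norm ((2/3) *\<^sub>R (x + y) - (1/3) *\<^sub>R z) \<le> 2/3 * norm (x + y) + 1/3 * norm z"
    using norm_triangle_ineq4[of "(2/3) *\<^sub>R (x + y)" "(1/3) *\<^sub>R z"] by simp
  also have "\<dots> \<le> 2/3 * (norm x + norm y) + 1/3 * norm z"
    using norm_triangle_ineq[of x y] by (intro add_right_mono mult_left_mono) auto
  finally show ?thesis .
qed

section \<open>Neighbours and edge strains in a numbered mesh\<close>

locale numbered_mesh =
  fixes \<Omega> :: "point set" and \<T> :: "point set set" and p :: numbering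
  assumes open_domain: "open \<Omega>"
    and mesh: "triangulation_of \<Omega> \<T>"
    and numbering: "vertex_numbering \<T> p"
begin

lemma triangulation: "triangulation \<T>"
  and simplex: "e \<in> \<T> \<Longrightarrow> 2 simplex e"
  and finite_mesh: "finite \<T>"
  and interior_subset_domain: "e \<in> \<T> \<Longrightarrow> interior e \<subseteq> \<Omega>"
  and domain_subset: "\<Omega> \<subseteq> \<Union>\<T>"
  using mesh closure_subset[of \<Omega>] unfolding triangulation_of_def triangulation_def by auto

lemma vertices:
  assumes "e \<in> \<T>"
  shows noncollinear: "\<not> collinear {p e 1, p e 2, p e 3}"
    and hull: "e = convex hull {p e 1, p e 2, p e 3}"
  using simplex_numbering[OF simplex[OF assms]] numbering assms unfolding vertex_numbering_def by blast+

lemma vertex_extreme: "e \<in> \<T> \<Longrightarrow> k \<in> {1, 2, 3} \<Longrightarrow> p e k extreme_point_of e"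
  using numbering unfolding vertex_numbering_def bij_betw_def by blast

lemma vertex_mem: "e \<in> \<T> \<Longrightarrow> k \<in> {1, 2, 3} \<Longrightarrow> p e k \<in> e"
  using vertex_extreme unfolding extreme_point_of_def by blast

lemma vertex_nxt_neq: "e \<in> \<T> \<Longrightarrow> k \<in> {1, 2, 3} \<Longrightarrow> p e k \<noteq> p e (nxt k)"
  using noncollinear[of e] by (auto simp: collinear_3_eq_affine_dependent)

lemma nxt_mem: "k \<in> {1, 2, 3} \<Longrightarrow> nxt k \<in> {1, 2, 3}"
  by auto

lemma compact_element: "e \<in> \<T> \<Longrightarrow> compact e"
  by (subst hull) (auto intro: finite_imp_compact_convex_hull)

lemma convex_element: "e \<in> \<T> \<Longrightarrow> convex e"
  by (subst hull) auto

lemma interior_nonempty: "e \<in> \<T> \<Longrightarrow> interior e \<noteq> {}"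
  using noncollinear_interior_nonempty[OF noncollinear] hull by metis

lemma element_unique: "e \<in> \<T> \<Longrightarrow> x \<in> interior e \<Longrightarrow> (THE e. e \<in> \<T> \<and> x \<in> interior e) = e"
  by (rule the_equality) (blast dest: triangulation_eq_if_interiors_meet[OF triangulation])+

lemma area_pos: "e \<in> \<T> \<Longrightarrow> 0 < area e"
proof -
  assume e: "e \<in> \<T>"
  have "e \<in> lmeasurable"
    using compact_element e by (simp add: lmeasurable_compact)
  moreover have "\<not> negligible e"
    using interior_nonempty[OF e] negligible_convex_interior[OF convex_element[OF e]] by blast
  ultimately show ?thesis
    using negligible_iff_measure0 measure_nonneg[of lebesgue e] by (metis less_eq_real_def)
qed

lemma edge_subset_unique:
  assumes "e \<in> \<T>" "e1 \<in> \<T>" "e2 \<in> \<T>" "e1 \<noteq> e" "e2 \<noteq> e" "k \<in> {1, 2, 3}"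
    and "edge p e k \<subseteq> e1" "edge p e k \<subseteq> e2"
  shows "e1 = e2"
  using triangulation_third_triangle[OF triangulation simplex, of e e1 e2 "p e k" "p e (nxt k)"]
    assms vertex_extreme nxt_mem vertex_nxt_neq unfolding edge_def by auto

lemma edge_strain_neighbour:
  assumes "e \<in> \<T>" "k \<in> {1, 2, 3}" "neighbour \<Omega> \<T> p e k e'"
  shows "edge_strain \<Omega> \<T> p u e k =
    (area e *\<^sub>R elem_grad u e + area e' *\<^sub>R elem_grad u e') /\<^sub>R (area e + area e')"
proof -
  have "(THE e'. neighbour \<Omega> \<T> p e k e') = e'"
  proof (rule the_equality)
    show "neighbour \<Omega> \<T> p e k e'" by (rule assms(3))
    fix e'' assume "neighbour \<Omega> \<T> p e k e''"
    then show "e'' = e'"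
      using assms edge_subset_unique[of e e'' e' k] unfolding neighbour_def by metis
  qed
  then show ?thesis
    using assms(3) unfolding edge_strain_def Let_def by auto
qed

text \<open>Makes it possible to count the elements having \<open>e'\<close> as neighbour by the
  edges of \<open>e'\<close>. By conformity the ends of the shared edge are vertices of
  \<open>e'\<close>, and any two distinct vertices of a triangle span one of its numbered edges, up
  to orientation.\<close>

lemma neighbour_has_edge:
  assumes "e \<in> \<T>" "k \<in> {1, 2, 3}" "neighbour \<Omega> \<T> p e k e'"
  shows "\<exists>k'\<in>{1, 2, 3}. edge p e' k' \<subseteq> e"
proof -
  have e': "e' \<in> \<T>" "p e k \<in> e'" "p e (nxt k) \<in> e'"
    using assms(3) unfolding neighbour_def edge_def by auto
  have "p e k extreme_point_of e'" "p e (nxt k) extreme_point_of e'"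
    using extreme_point_transfer[OF triangulation] assms e' vertex_extreme nxt_mem by blast+
  then have "p e k \<in> p e' ` {1, 2, 3}" "p e (nxt k) \<in> p e' ` {1, 2, 3}"
    using numbering e' unfolding vertex_numbering_def bij_betw_def by blast+
  then obtain i j where ij: "i \<in> {1, 2, 3}" "j \<in> {1, 2, 3}" "p e k = p e' i" "p e (nxt k) = p e' j"
    by blast
  moreover have "i \<noteq> j"
    using ij vertex_nxt_neq assms by metis
  ultimately have "\<exists>k'\<in>{1, 2, 3}. edge p e' k' = edge p e k"
    unfolding edge_def by (auto simp: closed_segment_commute)
  moreover have "edge p e k \<subseteq> e"
    unfolding edge_def using assms vertex_mem nxt_mem convex_element
    by (intro closed_segment_subset) auto
  ultimately show ?thesis
    by auto
qed

text \<open>Every element counted contains one of the three edges of \<open>e'\<close>, and each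
  edge lies in at most one element besides \<open>e'\<close>. The bound is 3 even for fixed
  \<open>k\<close>, since the two local numberings of a shared edge are unrelated.\<close>

lemma card_neighbours_le:
  assumes "e' \<in> \<T>" "k \<in> {1, 2, 3}"
  shows "card {e \<in> \<T>. neighbour \<Omega> \<T> p e k e'} \<le> 3"
proof -
  define S where "S k' = {e \<in> \<T>. e \<noteq> e' \<and> edge p e' k' \<subseteq> e}" for k'
  have fin: "finite (S k')" for k'
    unfolding S_def using finite_mesh by auto
  have "card (S k') \<le> 1" if "k' \<in> {1, 2, 3}" for k'
    using edge_subset_unique[OF assms(1)] that fin unfolding S_def One_nat_def
    by (subst card_le_Suc0_iff_eq) auto
  then have "(\<Sum>k'\<in>{1, 2, 3}. card (S k')) \<le> (\<Sum>k'\<in>{1::nat, 2, 3}. 1)"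
    by (intro sum_mono)
  moreover have "card (\<Union>k'\<in>{1, 2, 3}. S k') \<le> (\<Sum>k'\<in>{1, 2, 3}. card (S k'))"
    by (rule card_UN_le) auto
  moreover have "{e \<in> \<T>. neighbour \<Omega> \<T> p e k e'} \<subseteq> (\<Union>k'\<in>{1, 2, 3}. S k')"
  proof
    fix e assume "e \<in> {e \<in> \<T>. neighbour \<Omega> \<T> p e k e'}"
    then have e: "e \<in> \<T>" "neighbour \<Omega> \<T> p e k e'" by auto
    then have "e \<noteq> e'" unfolding neighbour_def by blast
    then show "e \<in> (\<Union>k'\<in>{1, 2, 3}. S k')"
      unfolding S_def using neighbour_has_edge[OF e(1) assms(2) e(2)] e(1) by blast
  qed
  then have "card {e \<in> \<T>. neighbour \<Omega> \<T> p e k e'} \<le> card (\<Union>k'\<in>{1, 2, 3}. S k')"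
    using fin by (intro card_mono) auto
  ultimately show ?thesis
    by simp
qed

text \<open>The Gauss points have barycentric coordinates 2/3, 1/6, 1/6. Inverting this 3 by 3
  system turns the prescribed Gauss values into vertex values, and vertex data determine an affine
  function uniquely.\<close>

lemma SSE_poly_vertex:
  assumes "e \<in> \<T>"
  shows "SSE_poly \<Omega> \<T> p u e \<in> P1 UNIV"
    and "k \<in> {1, 2, 3} \<Longrightarrow> SSE_poly \<Omega> \<T> p u e (p e k) =
       (2/3) *\<^sub>R (edge_strain \<Omega> \<T> p u e (prv k) + edge_strain \<Omega> \<T> p u e k)
       - (1/3) *\<^sub>R edge_strain \<Omega> \<T> p u e (nxt k)"
proof -
  define s where "s = edge_strain \<Omega> \<T> p u e"
  define val where "val k = (2/3) *\<^sub>R (s (prv k) + s k) - (1/3) *\<^sub>R s (nxt k)" for k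
  define P where "P f \<longleftrightarrow> f \<in> P1 UNIV \<and> (\<forall>k\<in>{1, 2, 3}. f (gauss_pt p e k) = (1/2) *\<^sub>R (s (prv k) + s k))" for f
  have gauss: "f (gauss_pt p e k) = (2/3) *\<^sub>R f (p e k) + (1/6) *\<^sub>R f (p e (nxt k)) + (1/6) *\<^sub>R f (p e (prv k))"
    if "f \<in> P1 UNIV" for f :: "point \<Rightarrow> point" and k
    unfolding gauss_pt_def using that by (intro P1_affine_comb) auto
  \<comment> \<open>An equivalence, because one direction gives existence of the polynomial and the
    other its uniqueness. It is checked componentwise as real linear arithmetic.\<close>
  have solve: "x1 = val 1 \<and> x2 = val 2 \<and> x3 = val 3 \<longleftrightarrow>
      (2/3) *\<^sub>R x1 + (1/6) *\<^sub>R x2 + (1/6) *\<^sub>R x3 = (1/2) *\<^sub>R (s 3 + s 1) \<and>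
      (2/3) *\<^sub>R x2 + (1/6) *\<^sub>R x3 + (1/6) *\<^sub>R x1 = (1/2) *\<^sub>R (s 1 + s 2) \<and>
      (2/3) *\<^sub>R x3 + (1/6) *\<^sub>R x1 + (1/6) *\<^sub>R x2 = (1/2) *\<^sub>R (s 2 + s 3)"
    for x1 x2 x3
  proof -
    have "(a = 2/3 * (s3 + s1) - 1/3 * s2 \<and> b = 2/3 * (s1 + s2) - 1/3 * s3 \<and> c = 2/3 * (s2 + s3) - 1/3 * s1)
      \<longleftrightarrow> (2/3 * a + 1/6 * b + 1/6 * c = 1/2 * (s3 + s1) \<and> 2/3 * b + 1/6 * c + 1/6 * a = 1/2 * (s1 + s2)
        \<and> 2/3 * c + 1/6 * a + 1/6 * b = 1/2 * (s2 + s3))" for a b c s1 s2 s3 :: real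
      by argo
    then show ?thesis
      unfolding val_def vec_eq_iff nxt_prv_simps vector_add_component vector_scaleR_component vector_minus_component
        all_conj_distrib[symmetric] real_scaleR_def by (simp only:)
  qed
  have P_iff: "P f \<longleftrightarrow> f (p e 1) = val 1 \<and> f (p e 2) = val 2 \<and> f (p e 3) = val 3"
    if "f \<in> P1 UNIV" for f :: "point \<Rightarrow> point"
    unfolding solve unfolding P_def using that gauss[OF that] by simp
  obtain f where f: "f \<in> P1 UNIV" "f (p e 1) = val 1" "f (p e 2) = val 2" "f (p e 3) = val 3"
    using P1_interpolation noncollinear[OF assms] by metis
  have "SSE_poly \<Omega> \<T> p u e = f"
    unfolding SSE_poly_def s_def[symmetric] P_def[symmetric]
  proof (rule the_equality)
    show "P f" using P_iff f by blast
    fix g assume "P g"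
    then show "g = f"
      using P_iff f P1_eqI[OF noncollinear[OF assms]] unfolding P_def by metis
  qed
  then show "SSE_poly \<Omega> \<T> p u e \<in> P1 UNIV"
    and "k \<in> {1, 2, 3} \<Longrightarrow> SSE_poly \<Omega> \<T> p u e (p e k) =
       (2/3) *\<^sub>R (edge_strain \<Omega> \<T> p u e (prv k) + edge_strain \<Omega> \<T> p u e k)
       - (1/3) *\<^sub>R edge_strain \<Omega> \<T> p u e (nxt k)"
    using f unfolding s_def val_def by auto
qed

text \<open>Both elements contain the ends of the shared edge, and \<open>u\<close> has one value at
  each end, so both gradients give the same increment. An average with weights summing to one keeps
  it.\<close>

lemma edge_strain_tangential:
  assumes u: "\<And>e. e \<in> \<T> \<Longrightarrow> u \<in> P1 e" and e: "e \<in> \<T>" "k \<in> {1, 2, 3}"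
  shows "edge_strain \<Omega> \<T> p u e k \<bullet> (p e (nxt k) - p e k) = elem_grad u e \<bullet> (p e (nxt k) - p e k)"
proof (cases "\<exists>e'. neighbour \<Omega> \<T> p e k e'")
  case True
  then obtain e' where n: "neighbour \<Omega> \<T> p e k e'" by blast
  let ?d = "p e (nxt k) - p e k"
  have e': "e' \<in> \<T>" "p e k \<in> e'" "p e (nxt k) \<in> e'"
    using n unfolding neighbour_def edge_def by auto
  have "elem_grad u e' \<bullet> ?d = u (p e (nxt k)) - u (p e k)"
    using elem_grad_P1(2)[OF u interior_nonempty] e' by blast
  moreover have "elem_grad u e \<bullet> ?d = u (p e (nxt k)) - u (p e k)"
    using elem_grad_P1(2)[OF u interior_nonempty] e vertex_mem nxt_mem by blast
  ultimately have "elem_grad u e' \<bullet> ?d = elem_grad u e \<bullet> ?d"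
    by simp
  moreover have "area e + area e' > 0"
    using area_pos e e' by (simp add: add_pos_pos)
  ultimately show ?thesis
    unfolding edge_strain_neighbour[OF e n]
    by (simp add: inner_add_left flip: distrib_right)
next
  case False
  then have "edge_strain \<Omega> \<T> p u e k = elem_grad u e"
    unfolding edge_strain_def by (rule if_not_P)
  then show ?thesis by simp
qed

lemma edge_strain_square_le:
  assumes e: "e \<in> \<T>" "k \<in> {1, 2, 3}"
  shows "area e * (norm (edge_strain \<Omega> \<T> p u e k))\<^sup>2 \<le>
    area e * (norm (elem_grad u e))\<^sup>2 +
    (\<Sum>e'\<in>{e' \<in> \<T>. neighbour \<Omega> \<T> p e k e'}. area e' * (norm (elem_grad u e'))\<^sup>2)"
proof (cases "\<exists>e'. neighbour \<Omega> \<T> p e k e'")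
  case True
  then obtain e' where n: "neighbour \<Omega> \<T> p e k e'" by blast
  then have e': "e' \<in> \<T>"
    unfolding neighbour_def by blast
  \<comment> \<open>The neighbour across an edge is unique, so the sum in the claim has a single
    term.\<close>
  have eq: "{e' \<in> \<T>. neighbour \<Omega> \<T> p e k e'} = {e'}"
    using n e' edge_subset_unique[of e _ e' k] e unfolding neighbour_def by blast
  define a b x y where "a = area e" "b = area e'" "x = norm (elem_grad u e)" "y = norm (elem_grad u e')"
  note defs = this
  have ab: "0 < a" "0 < b"
    using area_pos e e' by (auto simp: defs)
  have "norm (edge_strain \<Omega> \<T> p u e k) = norm (a *\<^sub>R elem_grad u e + b *\<^sub>R elem_grad u e') / (a + b)"
    unfolding edge_strain_neighbour[OF e n] using ab by (simp add: defs divide_inverse mult.commute)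
  also have "\<dots> \<le> (a * x + b * y) / (a + b)"
    using norm_triangle_ineq[of "a *\<^sub>R elem_grad u e" "b *\<^sub>R elem_grad u e'"] ab
    by (intro divide_right_mono) (auto simp: defs)
  finally have "(norm (edge_strain \<Omega> \<T> p u e k))\<^sup>2 \<le> ((a * x + b * y) / (a + b))\<^sup>2"
    by (intro power_mono) auto
  also have "\<dots> \<le> (a * x\<^sup>2 + b * y\<^sup>2) / (a + b)"
  proof -
    \<comment> \<open>Convexity of the square in exact form: the defect is a weighted
      variance.\<close>
    have "(a * x + b * y)\<^sup>2 + a * b * (x - y)\<^sup>2 = (a * x\<^sup>2 + b * y\<^sup>2) * (a + b)"
      by (simp add: power2_eq_square algebra_simps)
    moreover have "0 \<le> a * b * (x - y)\<^sup>2"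
      using ab by simp
    ultimately have "(a * x + b * y)\<^sup>2 \<le> (a * x\<^sup>2 + b * y\<^sup>2) * (a + b)"
      by linarith
    then show ?thesis
      using ab by (simp add: power_divide power2_eq_square[of "a + b"] divide_le_eq)
  qed
  finally have "a * (norm (edge_strain \<Omega> \<T> p u e k))\<^sup>2 \<le> a * ((a * x\<^sup>2 + b * y\<^sup>2) / (a + b))"
    using ab by (intro mult_left_mono) auto
  also have "\<dots> \<le> a * x\<^sup>2 + b * y\<^sup>2"
  proof -
    \<comment> \<open>Since \<open>a / (a + b)\<close> is at most one, no ratio of areas remains in
      the bound.\<close>
    have "a / (a + b) * (a * x\<^sup>2 + b * y\<^sup>2) \<le> 1 * (a * x\<^sup>2 + b * y\<^sup>2)"
      using ab by (intro mult_right_mono) auto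
    then show ?thesis by simp
  qed
  finally show ?thesis
    unfolding eq by (simp add: defs)
next
  case False
  then have "edge_strain \<Omega> \<T> p u e k = elem_grad u e"
    unfolding edge_strain_def by (rule if_not_P)
  then show ?thesis by (simp add: sum_nonneg)
qed

text \<open>Double counting: after exchanging the sums, \<open>w e'\<close> appears once for each
  element that has \<open>e'\<close> as its neighbour across edge \<open>k\<close>.\<close>

lemma sum_neighbours_le:
  fixes w :: "point set \<Rightarrow> real"
  assumes "\<And>e. e \<in> \<T> \<Longrightarrow> 0 \<le> w e" "k \<in> {1, 2, 3}"
  shows "(\<Sum>e\<in>\<T>. \<Sum>e'\<in>{e' \<in> \<T>. neighbour \<Omega> \<T> p e k e'}. w e') \<le> 3 * (\<Sum>e\<in>\<T>. w e)"
proof -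
  have "(\<Sum>e\<in>\<T>. \<Sum>e'\<in>{e' \<in> \<T>. neighbour \<Omega> \<T> p e k e'}. w e') =
      (\<Sum>e'\<in>\<T>. \<Sum>e\<in>{e \<in> \<T>. neighbour \<Omega> \<T> p e k e'}. w e')"
    by (rule sum.swap_restrict) (rule finite_mesh)+
  also have "\<dots> = (\<Sum>e'\<in>\<T>. real (card {e \<in> \<T>. neighbour \<Omega> \<T> p e k e'}) * w e')"
    by simp
  also have "\<dots> \<le> (\<Sum>e'\<in>\<T>. 3 * w e')"
  proof (rule sum_mono)
    fix e' assume "e' \<in> \<T>"
    then show "real (card {e \<in> \<T>. neighbour \<Omega> \<T> p e k e'}) * w e' \<le> 3 * w e'"
      using card_neighbours_le[of e' k] assms by (intro mult_right_mono) auto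
  qed
  finally show ?thesis
    by (simp add: sum_distrib_left)
qed

section \<open>Bounds on a single element\<close>

lemma SSE_square_integral_le:
  assumes e: "e \<in> \<T>"
  shows "(LINT x:interior e|lebesgue. SSE_poly \<Omega> \<T> p u e x \<bullet> SSE_poly \<Omega> \<T> p u e x)
    \<le> (\<Sum>k\<in>{1, 2, 3}. area e * (norm (edge_strain \<Omega> \<T> p u e k))\<^sup>2)"
proof -
  define f s where "f = SSE_poly \<Omega> \<T> p u e" and "s = edge_strain \<Omega> \<T> p u e"
  define M where "M = sqrt (\<Sum>k\<in>{1, 2, 3}. (norm (s k))\<^sup>2)"
  have bound: "norm ((2/3) *\<^sub>R (x + y) - (1/3) *\<^sub>R z) \<le> sqrt ((norm x)\<^sup>2 + (norm y)\<^sup>2 + (norm z)\<^sup>2)"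
    for x y z :: point
  proof (rule real_le_rsqrt)
    note norm_vertex_value_le[of x y z]
    then have "(norm ((2/3) *\<^sub>R (x + y) - (1/3) *\<^sub>R z))\<^sup>2 \<le> (2/3 * (norm x + norm y) + 1/3 * norm z)\<^sup>2"
      by (intro power_mono) auto
    also have "(2/3 * (a + b) + 1/3 * c)\<^sup>2 \<le> a\<^sup>2 + b\<^sup>2 + c\<^sup>2" for a b c :: real
    proof -
      \<comment> \<open>Cauchy-Schwarz against the vector (2/3, 2/3, 1/3), which has length one; the
        right-hand side is the remainder in Lagrange's identity.\<close>
      have "a\<^sup>2 + b\<^sup>2 + c\<^sup>2 - (2/3 * (a + b) + 1/3 * c)\<^sup>2 =
          4/9 * (a - b)\<^sup>2 + (2/3 * c - 1/3 * a)\<^sup>2 + (2/3 * c - 1/3 * b)\<^sup>2"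
        by (simp add: power2_eq_square field_simps)
      moreover have "0 \<le> \<dots>"
        by simp
      ultimately show ?thesis
        by linarith
    qed
    finally show "(norm ((2/3) *\<^sub>R (x + y) - (1/3) *\<^sub>R z))\<^sup>2 \<le> (norm x)\<^sup>2 + (norm y)\<^sup>2 + (norm z)\<^sup>2" .
  qed
  have v: "f (p e k) = (2/3) *\<^sub>R (s (prv k) + s k) - (1/3) *\<^sub>R s (nxt k)" if "k \<in> {1, 2, 3}" for k
    using SSE_poly_vertex(2)[OF e that] by (simp add: f_def s_def)
  have "norm (f (p e 1)) \<le> M" "norm (f (p e 2)) \<le> M" "norm (f (p e 3)) \<le> M"
    using bound[of "s 3" "s 1" "s 2"] bound[of "s 1" "s 2" "s 3"] bound[of "s 2" "s 3" "s 1"]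
      v[of 1] v[of 2] v[of 3] by (simp_all add: M_def add_ac)
  moreover have "f \<in> P1 e"
    using SSE_poly_vertex(1)[OF e] P1_mono unfolding f_def by blast
  ultimately have "(LINT x:interior e|lebesgue. f x \<bullet> f x) \<le> area e * M\<^sup>2"
    using P1_square_integral_le[OF _ hull[OF e]] by blast
  also have "M\<^sup>2 = (\<Sum>k\<in>{1, 2, 3}. (norm (s k))\<^sup>2)"
    unfolding M_def by (simp add: sum_nonneg)
  finally show ?thesis
    unfolding f_def s_def by (simp add: sum_distrib_left algebra_simps)
qed

lemma SSE_square_integral_ge:
  assumes u: "\<And>e. e \<in> \<T> \<Longrightarrow> u \<in> P1 e" and e: "e \<in> \<T>"
    and shape: "diameter e \<le> \<sigma> * inradius e" "0 < \<sigma>"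
  shows "area e * (norm (elem_grad u e))\<^sup>2 \<le>
    256 * \<sigma>\<^sup>2 * (LINT x:interior e|lebesgue. SSE_poly \<Omega> \<T> p u e x \<bullet> SSE_poly \<Omega> \<T> p u e x)"
proof -
  define f s where "f = SSE_poly \<Omega> \<T> p u e" and "s = edge_strain \<Omega> \<T> p u e"
  have fP: "f \<in> P1 e"
    using SSE_poly_vertex(1)[OF e] P1_mono unfolding f_def by blast
  have v: "f (p e k) = (2/3) *\<^sub>R (s (prv k) + s k) - (1/3) *\<^sub>R s (nxt k)" if "k \<in> {1, 2, 3}" for k
    using SSE_poly_vertex(2)[OF e that] by (simp add: f_def s_def)
  \<comment> \<open>A vertex where the smoothed gradient is largest, to serve as centre of the
    homothety in \<open>P1_square_integral_ge\<close>.\<close>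
  obtain k where k: "k \<in> {1, 2, 3}" "\<And>j. j \<in> {1, 2, 3} \<Longrightarrow> norm (f (p e j)) \<le> norm (f (p e k))"
  proof -
    let ?N = "(\<lambda>j. norm (f (p e j))) ` {1, 2, 3}"
    have "Max ?N \<in> ?N"
      by (rule Max_in) auto
    then obtain k where "k \<in> {1, 2, 3}" "Max ?N = norm (f (p e k))"
      by (rule imageE)
    moreover have "norm (f (p e j)) \<le> Max ?N" if "j \<in> {1, 2, 3}" for j
      using that by (intro Max_ge) auto
    ultimately show thesis
      using that by metis
  qed
  define M where "M = norm (f (p e k))"
  have le: "norm (f (p e 1)) \<le> M" "norm (f (p e 2)) \<le> M" "norm (f (p e 3)) \<le> M"
    using k(2) unfolding M_def by auto
  have I: "area e * M\<^sup>2 \<le> 64 * (LINT x:interior e|lebesgue. f x \<bullet> f x)"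
  proof -
    have "{p e k, p e (nxt k), p e (prv k)} = {p e 1, p e 2, p e 3}"
      using k(1) by auto
    then have "e = convex hull {p e k, p e (nxt k), p e (prv k)}"
      using hull[OF e] by metis
    then show ?thesis
      by (rule P1_square_integral_ge[OF fP]) (use k in \<open>auto simp: M_def\<close>)
  qed
  \<comment> \<open>The inverse system recovers an edge strain from vertex values with coefficients
    2/3, 2/3, -1/3, whose absolute values add up to 5/3; this is rounded up to 2.\<close>
  have s_le: "norm (s j) \<le> 2 * M" if "j \<in> {1, 2, 3}" for j
  proof -
    have "s j = (2/3) *\<^sub>R (f (p e j) + f (p e (nxt j))) - (1/3) *\<^sub>R f (p e (prv j))"
      using that by (auto simp: v vec_eq_iff diff_divide_distrib add_divide_distrib)
    then have "norm (s j) \<le> 2/3 * (norm (f (p e j)) + norm (f (p e (nxt j)))) + 1/3 * norm (f (p e (prv j)))"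
      using norm_vertex_value_le by metis
    moreover have "norm (f (p e j)) \<le> M" "norm (f (p e (nxt j))) \<le> M" "norm (f (p e (prv j))) \<le> M"
      using that le by auto
    moreover have "0 \<le> M"
      by (simp add: M_def)
    ultimately show ?thesis
      by argo
  qed
  have diam: "dist (p e (nxt j)) (p e j) \<le> diameter e" if "j \<in> {1, 2, 3}" for j
    using diameter_bounded_bound vertex_mem[OF e] nxt_mem that compact_imp_bounded[OF compact_element[OF e]] by blast
  have "0 < diameter e"
  proof -
    have "1 \<in> {1::nat, 2, 3}"
      by simp
    then have "0 < dist (p e (nxt 1)) (p e 1)" "dist (p e (nxt 1)) (p e 1) \<le> diameter e"
      using vertex_nxt_neq[OF e, of 1] diam[of 1] unfolding zero_less_dist_iff by metis+
    then show ?thesis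
      by (rule less_le_trans)
  qed
  from inscribed_ball[OF shape this]
  obtain x r where r: "0 < r" "cball x r \<subseteq> e" "diameter e \<le> 2 * \<sigma> * r" .
  define g where "g = elem_grad u e"
  \<comment> \<open>Along an edge the gradient may be replaced by the edge strain, of norm at most
    \<open>2 * M\<close>; the edge is no longer than the diameter, which is at most
    \<open>2 * \<sigma> * r\<close>.\<close>
  have D: "\<bar>g \<bullet> (p e (nxt j) - p e j)\<bar> \<le> 2 * M * (2 * \<sigma> * r)" if "j \<in> {1, 2, 3}" for j
  proof -
    have "\<bar>g \<bullet> (p e (nxt j) - p e j)\<bar> = \<bar>s j \<bullet> (p e (nxt j) - p e j)\<bar>"
      using edge_strain_tangential[OF u e that] by (simp add: g_def s_def)
    also have "\<dots> \<le> norm (s j) * norm (p e (nxt j) - p e j)"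
      by (rule Cauchy_Schwarz_ineq2)
    also have "\<dots> \<le> 2 * M * (2 * \<sigma> * r)"
      using s_le[OF that] diam[OF that] r by (intro mult_mono) (auto simp: dist_norm M_def)
    finally show ?thesis .
  qed
  have "2 * r * norm g \<le> 2 * M * (2 * \<sigma> * r)"
    by (rule inscribed_ball_gradient_le[of x r "p e 1" "p e 2" "p e 3"])
      (use D[of 1] D[of 2] D[of 3] r hull[OF e] in auto)
  then have "norm g \<le> 2 * \<sigma> * M"
    using r(1) by (simp add: mult.commute mult.left_commute)
  then have "(norm g)\<^sup>2 \<le> (2 * \<sigma> * M)\<^sup>2"
    by (intro power_mono) auto
  then have "area e * (norm g)\<^sup>2 \<le> area e * (2 * \<sigma> * M)\<^sup>2"
    by (intro mult_left_mono) auto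
  \<comment> \<open>The constant 256 is this 4 times the 64 from the integral bound.\<close>
  also have "\<dots> = 4 * \<sigma>\<^sup>2 * (area e * M\<^sup>2)"
    by (simp add: power_mult_distrib)
  also have "\<dots> \<le> 4 * \<sigma>\<^sup>2 * (64 * (LINT x:interior e|lebesgue. f x \<bullet> f x))"
    using I by (intro mult_left_mono) auto
  finally show ?thesis
    unfolding g_def f_def by simp
qed

section \<open>Assembly over the mesh\<close>

text \<open>What the element interiors miss of the domain lies in finitely many frontiers of convex
  sets and is null. Hence \<open>F\<close> has to be known only on the interiors, which suits
  gradients that are unspecified on edges.\<close>

lemma domain_integral:
  fixes F :: "point \<Rightarrow> real"
  assumes eq: "\<And>e x. e \<in> \<T> \<Longrightarrow> x \<in> interior e \<Longrightarrow> F x = G e x"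
    and int: "\<And>e. e \<in> \<T> \<Longrightarrow> set_integrable lebesgue (interior e) (G e)"
  shows "(LINT x:\<Omega>|lebesgue. F x) = (\<Sum>e\<in>\<T>. LINT x:interior e|lebesgue. G e x)"
proof -
  define U where "U = (\<Union>e\<in>\<T>. interior e)"
  have intF: "set_integrable lebesgue (interior e) F" if "e \<in> \<T>" for e
  proof -
    have "set_integrable lebesgue (interior e) F \<longleftrightarrow> set_integrable lebesgue (interior e) (G e)"
      using eq[OF that] by (intro set_integrable_cong) auto
    then show ?thesis
      using int[OF that] by blast
  qed
  have disj: "disjoint_family_on interior \<T>"
    unfolding disjoint_family_on_def
    using triangulation_eq_if_interiors_meet[OF triangulation] by blast
  have intU: "F absolutely_integrable_on U"
    unfolding U_def by (intro set_integrable_UN finite_mesh intF) auto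
  have "negligible (\<Union>e\<in>\<T>. frontier e)"
    using finite_mesh convex_element by (intro negligible_Union) (auto intro: negligible_convex_frontier)
  moreover have "\<Omega> - U \<subseteq> (\<Union>e\<in>\<T>. frontier e)"
  proof
    fix x assume "x \<in> \<Omega> - U"
    then obtain e where e: "e \<in> \<T>" "x \<in> e" "x \<notin> interior e"
      using domain_subset unfolding U_def by blast
    then have "x \<in> frontier e"
      unfolding frontier_def using closure_subset by blast
    then show "x \<in> (\<Union>e\<in>\<T>. frontier e)"
      using e(1) by blast
  qed
  ultimately have "negligible (\<Omega> - U)"
    by (rule negligible_subset)
  then have neg: "negligible {x \<in> U - \<Omega>. F x \<noteq> 0}" "negligible {x \<in> \<Omega> - U. F x \<noteq> 0}"
    using interior_subset_domain unfolding U_def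
    by (auto elim!: negligible_subset intro: negligible_subset[OF negligible_empty])
  have int\<Omega>: "F absolutely_integrable_on \<Omega>"
    using absolutely_integrable_spike_set[OF intU neg] .
  have "(LINT x:\<Omega>|lebesgue. F x) = integral \<Omega> F"
    by (rule set_lebesgue_integral_eq_integral(2)[OF int\<Omega>])
  also have "\<dots> = integral U F"
    by (rule integral_spike_set[OF neg(2,1)])
  also have "\<dots> = (LINT x:U|lebesgue. F x)"
    by (rule set_lebesgue_integral_eq_integral(2)[OF intU, symmetric])
  also have "\<dots> = (\<Sum>e\<in>\<T>. LINT x:interior e|lebesgue. F x)"
    unfolding U_def by (intro set_integral_finite_Union finite_mesh disj intF) auto
  also have "\<dots> = (\<Sum>e\<in>\<T>. LINT x:interior e|lebesgue. G e x)"
    using eq by (intro sum.cong set_lebesgue_integral_cong) auto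
  finally show ?thesis .
qed

lemma K_std_eq_sum:
  assumes u: "\<And>e. e \<in> \<T> \<Longrightarrow> u \<in> P1 e"
  shows "K_std \<Omega> u u = (\<Sum>e\<in>\<T>. area e * (norm (elem_grad u e))\<^sup>2)"
proof -
  have const: "(\<lambda>x. elem_grad u e) \<in> P1 e" for e
    unfolding P1_def by (auto intro!: exI[of _ "\<lambda>x. 0"] linear_zero)
  have "K_std \<Omega> u u = (\<Sum>e\<in>\<T>. LINT x:interior e|lebesgue. elem_grad u e \<bullet> elem_grad u e)"
    unfolding K_std_def
  proof (rule domain_integral)
    show "grad u x \<bullet> grad u x = elem_grad u e \<bullet> elem_grad u e" if "e \<in> \<T>" "x \<in> interior e" for e x
      using elem_grad_P1(1)[OF u interior_nonempty] that by metis
    show "set_integrable lebesgue (interior e) (\<lambda>x. elem_grad u e \<bullet> elem_grad u e)" if "e \<in> \<T>" for e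
      by (rule P1_square_integrable[OF const compact_element[OF that]])
  qed
  also have "\<dots> = (\<Sum>e\<in>\<T>. area e * (norm (elem_grad u e))\<^sup>2)"
  proof (rule sum.cong[OF refl])
    fix e assume e: "e \<in> \<T>"
    have b: "bounded e"
      using compact_element[OF e] by (rule compact_imp_bounded)
    then have "interior e \<in> lmeasurable"
      by (rule lmeasurable_interior)
    then have "(LINT x:interior e|lebesgue. elem_grad u e \<bullet> elem_grad u e) =
        measure lebesgue (interior e) * (norm (elem_grad u e))\<^sup>2"
      by (subst set_integral_const) (auto simp: fmeasurable_def power2_norm_eq_inner)
    also have "measure lebesgue (interior e) = area e"
      using measure_interior[OF b] negligible_convex_frontier[OF convex_element[OF e]] by simp
    finally show "(LINT x:interior e|lebesgue. elem_grad u e \<bullet> elem_grad u e) =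
        area e * (norm (elem_grad u e))\<^sup>2" .
  qed
  finally show ?thesis .
qed

lemma K_SSE_eq_sum:
  "K_SSE \<Omega> \<T> p u u =
    (\<Sum>e\<in>\<T>. LINT x:interior e|lebesgue. SSE_poly \<Omega> \<T> p u e x \<bullet> SSE_poly \<Omega> \<T> p u e x)"
  unfolding K_SSE_def
proof (rule domain_integral)
  show "SSE_grad \<Omega> \<T> p u x \<bullet> SSE_grad \<Omega> \<T> p u x = SSE_poly \<Omega> \<T> p u e x \<bullet> SSE_poly \<Omega> \<T> p u e x"
    if "e \<in> \<T>" "x \<in> interior e" for e x
    unfolding SSE_grad_def element_unique[OF that] ..
  show "set_integrable lebesgue (interior e) (\<lambda>x. SSE_poly \<Omega> \<T> p u e x \<bullet> SSE_poly \<Omega> \<T> p u e x)"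
    if "e \<in> \<T>" for e
    by (rule P1_square_integrable[OF P1_mono[OF SSE_poly_vertex(1)[OF that]] compact_element[OF that]]) simp
qed

lemma K_SSE_le:
  assumes u: "\<And>e. e \<in> \<T> \<Longrightarrow> u \<in> P1 e"
  shows "K_SSE \<Omega> \<T> p u u \<le> 12 * K_std \<Omega> u u"
proof -
  define w where "w e = area e * (norm (elem_grad u e))\<^sup>2" for e
  have w: "0 \<le> w e" for e
    by (simp add: w_def)
  have K: "K_std \<Omega> u u = (\<Sum>e\<in>\<T>. w e)"
    unfolding w_def by (rule K_std_eq_sum[OF u])
  \<comment> \<open>Each element contributes once through its own gradient and at most three times
    as a neighbour, hence 4 per local edge and 12 over the three local edges.\<close>
  have edge: "(\<Sum>e\<in>\<T>. area e * (norm (edge_strain \<Omega> \<T> p u e k))\<^sup>2) \<le> 4 * K_std \<Omega> u u"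
    if k: "k \<in> {1, 2, 3}" for k
  proof -
    have "(\<Sum>e\<in>\<T>. area e * (norm (edge_strain \<Omega> \<T> p u e k))\<^sup>2)
        \<le> (\<Sum>e\<in>\<T>. w e + (\<Sum>e'\<in>{e' \<in> \<T>. neighbour \<Omega> \<T> p e k e'}. w e'))"
      unfolding w_def by (intro sum_mono edge_strain_square_le k)
    also have "\<dots> \<le> (\<Sum>e\<in>\<T>. w e) + 3 * (\<Sum>e\<in>\<T>. w e)"
      unfolding sum.distrib by (intro add_left_mono sum_neighbours_le w k)
    finally show ?thesis
      unfolding K by simp
  qed
  have "K_SSE \<Omega> \<T> p u u \<le>
      (\<Sum>e\<in>\<T>. \<Sum>k\<in>{1, 2, 3}. area e * (norm (edge_strain \<Omega> \<T> p u e k))\<^sup>2)"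
    unfolding K_SSE_eq_sum by (intro sum_mono SSE_square_integral_le)
  also have "\<dots> = (\<Sum>k\<in>{1, 2, 3}. \<Sum>e\<in>\<T>. area e * (norm (edge_strain \<Omega> \<T> p u e k))\<^sup>2)"
    by (rule sum.swap)
  also have "\<dots> \<le> (\<Sum>k\<in>{1::nat, 2, 3}. 4 * K_std \<Omega> u u)"
    by (intro sum_mono edge)
  finally show ?thesis
    by simp
qed

lemma K_std_le:
  assumes u: "\<And>e. e \<in> \<T> \<Longrightarrow> u \<in> P1 e"
    and shape: "\<And>e. e \<in> \<T> \<Longrightarrow> diameter e \<le> \<sigma> * inradius e" "0 < \<sigma>"
  shows "K_std \<Omega> u u \<le> 256 * \<sigma>\<^sup>2 * K_SSE \<Omega> \<T> p u u"
proof -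
  have "K_std \<Omega> u u = (\<Sum>e\<in>\<T>. area e * (norm (elem_grad u e))\<^sup>2)"
    by (rule K_std_eq_sum[OF u])
  also have "\<dots> \<le> (\<Sum>e\<in>\<T>. 256 * \<sigma>\<^sup>2 *
      (LINT x:interior e|lebesgue. SSE_poly \<Omega> \<T> p u e x \<bullet> SSE_poly \<Omega> \<T> p u e x))"
    by (intro sum_mono SSE_square_integral_ge u shape)
  finally show ?thesis
    unfolding K_SSE_eq_sum sum_distrib_left .
qed

end

theorem theorem3p4:
  fixes \<Omega> :: "point set" and H :: "real set"
    and \<T> :: "real \<Rightarrow> point set set" and p :: "real \<Rightarrow> numbering"
  assumes "polygonal_domain \<Omega>"
    and "\<And>h. h \<in> H \<Longrightarrow> 0 < h"
    and "\<And>h. h \<in> H \<Longrightarrow> triangulation_of \<Omega> (\<T> h)"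
    and "quasi_uniform H \<T>"
    and "\<And>h. h \<in> H \<Longrightarrow> vertex_numbering (\<T> h) (p h)"
  shows "\<exists>C\<^sub>l C\<^sub>u. 0 < C\<^sub>l \<and> 0 < C\<^sub>u \<and>
    (\<forall>h\<in>H. \<forall>u\<in>V_h \<Omega> (\<T> h).
       C\<^sub>l * K_std \<Omega> u u \<le> K_SSE \<Omega> (\<T> h) (p h) u u \<and>
       K_SSE \<Omega> (\<T> h) (p h) u u \<le> C\<^sub>u * K_std \<Omega> u u)"
proof -
  obtain \<sigma> where \<sigma>: "0 < \<sigma>" "\<forall>h\<in>H. \<forall>e\<in>\<T> h. diameter e \<le> \<sigma> * inradius e"
    using assms(4) unfolding quasi_uniform_def shape_regular_def by blast
  \<comment> \<open>Both constants are uniform in \<open>h\<close>: 12 is absolute, and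
    \<open>\<sigma>\<close> is the one shape-regularity constant of the whole family.\<close>
  have "1 / (256 * \<sigma>\<^sup>2) * K_std \<Omega> u u \<le> K_SSE \<Omega> (\<T> h) (p h) u u \<and>
      K_SSE \<Omega> (\<T> h) (p h) u u \<le> 12 * K_std \<Omega> u u" if h: "h \<in> H" and "u \<in> V_h \<Omega> (\<T> h)" for h u
  proof
    interpret numbered_mesh \<Omega> "\<T> h" "p h"
      using assms(1,3,5) h by unfold_locales (auto simp: polygonal_domain_def)
    have u: "\<And>e. e \<in> \<T> h \<Longrightarrow> u \<in> P1 e"
      using that unfolding V_h_def by blast
    show "K_SSE \<Omega> (\<T> h) (p h) u u \<le> 12 * K_std \<Omega> u u"
      by (rule K_SSE_le[OF u])
    have "K_std \<Omega> u u \<le> 256 * \<sigma>\<^sup>2 * K_SSE \<Omega> (\<T> h) (p h) u u"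
      using K_std_le[OF u _ \<sigma>(1)] \<sigma>(2) h by blast
    then show "1 / (256 * \<sigma>\<^sup>2) * K_std \<Omega> u u \<le> K_SSE \<Omega> (\<T> h) (p h) u u"
      using \<sigma>(1) by (simp add: divide_le_eq mult.commute)
  qed
  moreover have "0 < 1 / (256 * \<sigma>\<^sup>2)"
    using \<sigma>(1) by simp
  ultimately show ?thesis
    by (intro exI[of _ "1 / (256 * \<sigma>\<^sup>2)"] exI[of _ "12"]) auto
qed

end
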